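(* Let $\lambda>0$, and let $\bm{\alpha}$ and $\bm{\Gamma}$ be feasible solutions of the dual problem, i.e. $\bm{0}\le\bm{\alpha}\le\bm{1}$ and $\bm{\Gamma}\succeq\bm{O}$, such that $\bm{M}_\lambda(\bm{\alpha},\bm{\Gamma})$ is primal feasible, i.e. $\bm{M}_\lambda(\bm{\alpha},\bm{\Gamma})\succeq\bm{O}$. Then the optimal solution $\bm{M}^\star$ of the primal problem $\min_{\bm{M}\succeq\bm{O}}P_\lambda(\bm{M})$ satisfies $$\left\|\bm{M}^\star-\bm{M}_{\lambda}(\bm{\alpha},\bm{\Gamma})\right\|_F^2\le \frac{G_{D_{\lambda}}(\bm{\alpha},\bm{\Gamma})}{\lambda},$$ where $G_{D_{\lambda}}(\bm{\alpha},\bm{\Gamma}):=P_{\lambda}(\bm{M}_{\lambda}(\bm{\alpha},\bm{\Gamma}))-D_{\lambda}(\bm{\alpha},\bm{\Gamma})$.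
   Context: Let $\bm{x}_1,\dots,\bm{x}_n\in\mathbb{R}^d$ have labels $y_1,\dots,y_n$ in a discrete set, and let $\mathcal{T}=\{(i,j,l)\in\{1,\dots,n\}^3\mid y_i=y_j,\ i\neq j,\ y_i\neq y_l\}$. For $(i,j,l)\in\mathcal{T}$ put $\bm{H}_{ijl}=(\bm{x}_i-\bm{x}_l)(\bm{x}_i-\bm{x}_l)^\top-(\bm{x}_i-\bm{x}_j)(\bm{x}_i-\bm{x}_j)^\top$. $\langle \bm{A},\bm{B}\rangle=\mathrm{tr}(\bm{A}^\top\bm{B})$, $\|\bm{A}\|_F^2=\langle\bm{A},\bm{A}\rangle$, and $\bm{M}\succeq\bm{O}$ means that $\bm{M}\in\mathbb{R}^{d\times d}$ is (symmetric) positive semi-definite. The loss $\ell:\mathbb{R}\to\mathbb{R}$ is either the hinge loss $\ell(x)=\max\{0,1-x\}$ (parameter $\gamma=0$), or, for a parameter $\gamma>0$, the smoothed hinge loss: $\ell(x)=0$ for $x>1$, $\ell(x)=\frac{1}{2\gamma}(1-x)^2$ for $1-\gamma\le x\le1$, $\ell(x)=1-x-\frac{\gamma}{2}$ for $x<1-\gamma$. Primal objective: $P_\lambda(\bm{M})=\sum_{(i,j,l)\in\mathcal{T}}\ell(\langle\bm{M},\bm{H}_{ijl}\rangle)+\frac{\lambda}{2}\|\bm{M}\|_F^2$, minimized over $\bm{M}\succeq\bm{O}$. Dual objective: for $\bm{\alpha}=(\alpha_{ijl})\in\mathbb{R}^{|\mathcal{T}|}$ and $\bm{\Gamma}\in\mathbb{R}^{d\times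 d}$, $D_\lambda(\bm{\alpha},\bm{\Gamma})=-\frac{\gamma}{2}\|\bm{\alpha}\|_2^2+\bm{\alpha}^\top\bm{1}-\frac{\lambda}{2}\|\bm{M}_\lambda(\bm{\alpha},\bm{\Gamma})\|_F^2$, where $\bm{M}_\lambda(\bm{\alpha},\bm{\Gamma})=\frac{1}{\lambda}\left[\sum_{(i,j,l)\in\mathcal{T}}\alpha_{ijl}\bm{H}_{ijl}+\bm{\Gamma}\right]$; it is maximized over $\bm{0}\le\bm{\alpha}\le\bm{1}$ (componentwise), $\bm{\Gamma}\succeq\bm{O}$. *)

theory Defs
  imports "HOL-Analysis.Analysis"
begin

definition frob_inner :: "real^'d^'d \<Rightarrow> real^'d^'d \<Rightarrow> real" where
  "frob_inner A B = trace (transpose A ** B)"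

definition frob_norm :: "real^'d^'d \<Rightarrow> real" where
  "frob_norm A = sqrt (frob_inner A A)"

definition psd :: "real^'d^'d \<Rightarrow> bool" where
  "psd M \<longleftrightarrow> transpose M = M \<and> (\<forall>v. 0 \<le> v \<bullet> (M *v v))"

definition outer_prod :: "real^'d \<Rightarrow> real^'d \<Rightarrow> real^'d^'d" where
  "outer_prod u v = (\<chi> a b. u $ a * v $ b)"

text \<open>A sample of size \<open>n\<close> is given by functions \<open>x\<close> (feature vectors) and \<open>y\<close> (labels),
  of which only the values at the indices \<open>1, \<dots>, n\<close> matter.\<close>

definition triplets :: "nat \<Rightarrow> (nat \<Rightarrow> 'c) \<Rightarrow> (nat \<times> nat \<times> nat) set" where
  "triplets n y = {(i, j, l). i \<in> {1..n} \<and> j \<in> {1..n} \<and> l \<in> {1..n} \<and>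
     y i = y j \<and> i \<noteq> j \<and> y i \<noteq> y l}"

definition H :: "(nat \<Rightarrow> real^'d) \<Rightarrow> nat \<times> nat \<times> nat \<Rightarrow> real^'d^'d" where
  "H x = (\<lambda>(i, j, l). outer_prod (x i - x l) (x i - x l) - outer_prod (x i - x j) (x i - x j))"

text \<open>The value \<open>\<gamma> = 0\<close> selects the hinge loss, \<open>\<gamma> > 0\<close> the smoothed hinge loss.\<close>

definition loss :: "real \<Rightarrow> real \<Rightarrow> real" where
  "loss \<gamma> z =
    (if \<gamma> = 0 then max 0 (1 - z)
     else if z > 1 then 0
     else if 1 - \<gamma> \<le> z then 1 / (2 * \<gamma>) * (1 - z)\<^sup>2
     else 1 - z - \<gamma> / 2)"

definition primal_obj ::
  "nat \<Rightarrow> (nat \<Rightarrow> real^'d) \<Rightarrow> (nat \<Rightarrow> 'c) \<Rightarrow> real \<Rightarrow> real \<Rightarrow> real^'d^'d \<Rightarrow> real" where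
  "primal_obj n x y \<gamma> lam M =
    (\<Sum>t\<in>triplets n y. loss \<gamma> (frob_inner M (H x t))) + lam / 2 * (frob_norm M)\<^sup>2"

text \<open>Dual vectors \<open>\<alpha>\<close> are functions on all index triples; only their values on
  \<open>triplets n y\<close> are ever used.\<close>

definition M_dual ::
  "nat \<Rightarrow> (nat \<Rightarrow> real^'d) \<Rightarrow> (nat \<Rightarrow> 'c) \<Rightarrow> real \<Rightarrow>
   (nat \<times> nat \<times> nat \<Rightarrow> real) \<Rightarrow> real^'d^'d \<Rightarrow> real^'d^'d" where
  "M_dual n x y lam \<alpha> \<Gamma> = (1 / lam) *\<^sub>R ((\<Sum>t\<in>triplets n y. \<alpha> t *\<^sub>R H x t) + \<Gamma>)"

definition dual_obj ::
  "nat \<Rightarrow> (nat \<Rightarrow> real^'d) \<Rightarrow> (nat \<Rightarrow> 'c) \<Rightarrow> real \<Rightarrow> real \<Rightarrow>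
   (nat \<times> nat \<times> nat \<Rightarrow> real) \<Rightarrow> real^'d^'d \<Rightarrow> real" where
  "dual_obj n x y \<gamma> lam \<alpha> \<Gamma> =
    - \<gamma> / 2 * (\<Sum>t\<in>triplets n y. (\<alpha> t)\<^sup>2) + (\<Sum>t\<in>triplets n y. \<alpha> t)
    - lam / 2 * (frob_norm (M_dual n x y lam \<alpha> \<Gamma>))\<^sup>2"

definition duality_gap ::
  "nat \<Rightarrow> (nat \<Rightarrow> real^'d) \<Rightarrow> (nat \<Rightarrow> 'c) \<Rightarrow> real \<Rightarrow> real \<Rightarrow>
   (nat \<times> nat \<times> nat \<Rightarrow> real) \<Rightarrow> real^'d^'d \<Rightarrow> real" where
  "duality_gap n x y \<gamma> lam \<alpha> \<Gamma> =
    primal_obj n x y \<gamma> lam (M_dual n x y lam \<alpha> \<Gamma>) - dual_obj n x y \<gamma> lam \<alpha> \<Gamma>"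

end

theory Submission
  imports Defs
begin

text \<open>
  The gap splits at \<open>P(M*)\<close>: both halves are at least \<open>\<lambda>/2 \<parallel>M* - M\<^sub>\<lambda>(\<alpha>, \<Gamma>)\<parallel>\<^sup>2\<close>.
  For \<open>P(M\<^sub>\<lambda>(\<alpha>, \<Gamma>)) - P(M*)\<close> this is the \<open>\<lambda>\<close>-strong convexity of \<open>P\<close> at its minimizer over the
  convex cone of positive semi-definite matrices. For \<open>P(M*) - D(\<alpha>, \<Gamma>)\<close>, the Fenchel inequality
  \<open>loss z \<ge> \<alpha> - \<gamma>/2 \<alpha>\<^sup>2 - \<alpha> z\<close> makes the difference at least
  \<open>\<lambda>/2 \<parallel>M* - M\<^sub>\<lambda>(\<alpha>, \<Gamma>)\<parallel>\<^sup>2 + \<langle>M*, \<Gamma>\<rangle>\<close>, and the last term is nonnegative because the cone is self-dual.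
\<close>

section \<open>Positive semi-definite matrices\<close>

lemma frob_inner_eq_inner: "frob_inner A B = A \<bullet> B"
proof -
  have "frob_inner A B = (\<Sum>i\<in>UNIV. \<Sum>k\<in>UNIV. A $ k $ i * B $ k $ i)"
    by (simp add: frob_inner_def trace_def matrix_matrix_mult_def transpose_def)
  also have "\<dots> = (\<Sum>k\<in>UNIV. \<Sum>i\<in>UNIV. A $ k $ i * B $ k $ i)"
    by (rule sum.swap)
  finally show ?thesis
    by (simp add: inner_vec_def)
qed

lemma frob_norm_eq_norm: "frob_norm A = norm A"
  by (simp add: frob_norm_def frob_inner_eq_inner norm_eq_sqrt_inner)

lemma transpose_add: "transpose (A + B) = transpose A + transpose B"
  by (simp add: transpose_def vec_eq_iff)

lemma transpose_scaleR: "transpose (c *\<^sub>R A) = c *\<^sub>R transpose A"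
  by (simp add: transpose_def vec_eq_iff)

lemma psd_add: "psd A \<Longrightarrow> psd B \<Longrightarrow> psd (A + B)"
  by (simp add: psd_def transpose_add matrix_vector_mult_add_rdistrib inner_add_right)

lemma psd_scaleR: "psd A \<Longrightarrow> 0 \<le> c \<Longrightarrow> psd (c *\<^sub>R A)"
  by (simp add: psd_def transpose_scaleR scaleR_matrix_vector_assoc[symmetric])

lemma psd_sym: "psd A \<Longrightarrow> A $ i $ j = A $ j $ i"
  unfolding psd_def transpose_def by (metis vec_lambda_beta)

lemma outer_prod_mult_vector: "outer_prod u v *v w = (v \<bullet> w) *\<^sub>R u"
  by (simp add: outer_prod_def matrix_vector_mult_def vec_eq_iff inner_vec_def
      sum_distrib_left mult_ac)

lemma inner_outer_prod: "M \<bullet> outer_prod u u = u \<bullet> (M *v u)"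
  by (simp add: outer_prod_def inner_vec_def matrix_vector_mult_def sum_distrib_left mult_ac)

text \<open>Symmetry of \<open>A\<close> merges the two cross terms. With \<open>s\<close> free,
  positivity of the form becomes a condition on a real quadratic polynomial.\<close>

lemma quadratic_form_axis_perturb:
  assumes "psd A"
  shows "(v + s *\<^sub>R axis k 1) \<bullet> (A *v (v + s *\<^sub>R axis k 1))
    = v \<bullet> (A *v v) + 2 * s * (A *v v) $ k + s\<^sup>2 * A $ k $ k"
proof -
  have "v \<bullet> (A *v axis k 1) = (transpose A *v v) \<bullet> axis k 1"
    by (simp add: dot_lmul_matrix[symmetric])
  also have "\<dots> = (A *v v) $ k"
    using assms by (simp add: psd_def inner_axis)
  finally have 1: "v \<bullet> (A *v axis k 1) = (A *v v) $ k" .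
  have 2: "axis k 1 \<bullet> (A *v axis k 1) = A $ k $ k"
    by (simp add: inner_axis' matrix_vector_mul_component inner_axis)
  show ?thesis
    using 1 2
    by (simp add: matrix_vector_right_distrib matrix_vector_mult_scaleR inner_add_left
        inner_add_right inner_axis' power2_eq_square algebra_simps)
qed

lemma psd_diag_nonneg: "psd A \<Longrightarrow> 0 \<le> A $ k $ k"
  using quadratic_form_axis_perturb[of A 0 1 k] by (simp add: psd_def) metis

text \<open>Cauchy-Schwarz for the semi-inner product \<open>u \<bullet> (A *v w)\<close>, taken at
  \<open>axis k 1\<close> and \<open>v\<close>.\<close>

lemma psd_mult_component_sq_le:
  assumes "psd A"
  shows "((A *v v) $ k)\<^sup>2 \<le> A $ k $ k * (v \<bullet> (A *v v))"
proof -
  define q b a where "q = v \<bullet> (A *v v)" and "b = (A *v v) $ k" and "a = A $ k $ k"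
  have nonneg: "0 \<le> q + 2 * s * b + s\<^sup>2 * a" for s
    using assms quadratic_form_axis_perturb[OF assms, of v s k]
    by (simp add: psd_def q_def b_def a_def) metis
  have "b\<^sup>2 \<le> a * q"
  proof (cases "a = 0")
    case True
    \<comment> \<open>The polynomial is now affine in \<open>s\<close>; if \<open>b\<close> were
      nonzero, this \<open>s\<close> would give it the value -1.\<close>
    show ?thesis
      using nonneg[of "- (q + 1) / (2 * b)"] True
      by (cases "b = 0") (auto simp: field_simps)
  next
    case False
    then have "a > 0"
      using psd_diag_nonneg[OF assms, of k] by (simp add: a_def)
    \<comment> \<open>The minimizer of the polynomial is \<open>s = - b / a\<close>.\<close>
    then show ?thesis
      using nonneg[of "- b / a"] by (simp add: field_simps power2_eq_square)
  qed
  then show ?thesis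
    by (simp add: q_def b_def a_def)
qed

lemma psd_entry_eq_0:
  assumes "psd A" "A $ k $ k = 0"
  shows "A $ k $ j = 0"
proof -
  have "((A *v axis j 1) $ k)\<^sup>2 \<le> 0"
    using psd_mult_component_sq_le[OF assms(1), of "axis j 1" k] assms(2) by simp
  then show ?thesis
    by (simp add: matrix_vector_mul_component inner_axis)
qed

text \<open>
  One step of symmetric Gaussian elimination (Cholesky) splits off a rank-one summand and clears a
  diagonal entry, which avoids the spectral theorem.
\<close>

lemma psd_inner_nonneg:
  assumes "psd M" "psd A"
  shows "0 \<le> M \<bullet> A"
  using assms(2)
\<comment> \<open>Each elimination step lowers the number of nonzero diagonal entries; once there
  are none, \<open>psd_entry_eq_0\<close> makes the matrix zero.\<close>
proof (induction "card {k. A $ k $ k \<noteq> 0}" arbitrary: A rule: less_induct)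
  case less
  note psdA = less.prems
  show ?case
  proof (cases "\<exists>k. A $ k $ k \<noteq> 0")
    case False
    then have "A = 0"
      using psd_entry_eq_0[OF psdA] by (simp add: vec_eq_iff)
    then show ?thesis by simp
  next
    case True
    then obtain k where k: "A $ k $ k \<noteq> 0" ..
    define a where "a = A $ k $ k"
    have "a > 0"
      using psd_diag_nonneg[OF psdA, of k] k by (simp add: a_def)
    \<comment> \<open>The Schur complement of the pivot \<open>a\<close>, padded with a zero row and
      column. Its positivity is exactly the Cauchy-Schwarz bound above.\<close>
    define B where "B = A - (1 / a) *\<^sub>R outer_prod (A $ k) (A $ k)"
    have B_entry: "B $ i $ j = A $ i $ j - A $ k $ i * A $ k $ j / a" for i j
      by (simp add: B_def outer_prod_def)
    have "psd B"
      unfolding psd_def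
    proof (intro conjI allI)
      show "transpose B = B"
        using psd_sym[OF psdA] by (simp add: vec_eq_iff transpose_def B_entry)
    next
      fix v
      have row: "A $ k \<bullet> v = (A *v v) $ k"
        by (simp add: matrix_vector_mul_component)
      have "B *v v = A *v v - ((A *v v) $ k / a) *\<^sub>R A $ k"
        by (simp add: B_def matrix_vector_mult_diff_rdistrib scaleR_matrix_vector_assoc[symmetric]
            outer_prod_mult_vector row)
      then have "v \<bullet> (B *v v) = v \<bullet> (A *v v) - ((A *v v) $ k)\<^sup>2 / a"
        using row by (simp add: inner_diff_right inner_commute power2_eq_square)
      moreover have "((A *v v) $ k)\<^sup>2 / a \<le> v \<bullet> (A *v v)"
        using psd_mult_component_sq_le[OF psdA, of v k] \<open>a > 0\<close>
        by (simp add: a_def field_simps)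
      ultimately show "0 \<le> v \<bullet> (B *v v)"
        by simp
    qed
    have "{i. B $ i $ i \<noteq> 0} \<subset> {i. A $ i $ i \<noteq> 0}"
    proof (rule psubsetI)
      \<comment> \<open>No fill-in: where \<open>A $ i $ i\<close> vanishes, so does
        \<open>A $ k $ i\<close>, hence nothing is subtracted there.\<close>
      show "{i. B $ i $ i \<noteq> 0} \<subseteq> {i. A $ i $ i \<noteq> 0}"
        using psd_entry_eq_0[OF psdA] psd_sym[OF psdA] by (auto simp: B_entry)
      have "B $ k $ k = 0"
        using \<open>a > 0\<close> by (simp add: B_entry a_def)
      then show "{i. B $ i $ i \<noteq> 0} \<noteq> {i. A $ i $ i \<noteq> 0}"
        using k by blast
    qed
    then have "0 \<le> M \<bullet> B"
      using less.hyps \<open>psd B\<close> by (simp add: psubset_card_mono)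
    \<comment> \<open>The rank-one summand contributes a value of the quadratic form of
      \<open>M\<close>.\<close>
    moreover have "M \<bullet> A = M \<bullet> B + (A $ k \<bullet> (M *v A $ k)) / a"
      by (simp add: B_def inner_diff_right inner_outer_prod)
    ultimately show ?thesis
      using assms(1) \<open>a > 0\<close> by (simp add: psd_def)
  qed
qed

section \<open>The loss as a Fenchel conjugate\<close>

text \<open>For \<gamma> > 0 the difference of the two sides is a perfect square on the quadratic
  piece, and a sum of two nonnegative terms on the left linear piece.\<close>

lemma loss_ge_linear:
  assumes "0 \<le> \<gamma>" "0 \<le> a" "a \<le> 1"
  shows "a - \<gamma> / 2 * a\<^sup>2 - a * z \<le> loss \<gamma> z"
proof -
  consider "\<gamma> = 0" | "\<gamma> > 0" "z > 1" | "\<gamma> > 0" "z \<le> 1" "1 - \<gamma> \<le> z" | "\<gamma> > 0" "z \<le> 1" "z < 1 - \<gamma>"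
    using assms by linarith
  then show ?thesis
  proof cases
    case 1
    have "a * (1 - z) \<le> max 0 (1 - z)"
    proof (cases "z \<le> 1")
      case True
      then show ?thesis using assms mult_right_mono[of a 1 "1 - z"] by simp
    next
      case False
      then show ?thesis using assms mult_nonneg_nonpos[of a "1 - z"] by simp
    qed
    then show ?thesis using 1 by (simp add: loss_def algebra_simps)
  next
    case 2
    then have "a * (1 - z) \<le> 0"
      using assms by (simp add: mult_nonneg_nonpos)
    also have "0 \<le> \<gamma> / 2 * a\<^sup>2"
      using 2 by simp
    finally have "a * (1 - z) \<le> \<gamma> / 2 * a\<^sup>2" .
    then show ?thesis using 2 by (simp add: loss_def algebra_simps)
  next
    case 3
    have "1 / (2 * \<gamma>) * (1 - z)\<^sup>2 - (a - \<gamma> / 2 * a\<^sup>2 - a * z) = (1 - z - \<gamma> * a)\<^sup>2 / (2 * \<gamma>)"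
      using 3 by (simp add: field_simps power2_eq_square)
    moreover have "0 \<le> (1 - z - \<gamma> * a)\<^sup>2 / (2 * \<gamma>)"
      using 3 by simp
    ultimately have "a - \<gamma> / 2 * a\<^sup>2 - a * z \<le> 1 / (2 * \<gamma>) * (1 - z)\<^sup>2"
      by linarith
    then show ?thesis using 3 by (simp add: loss_def)
  next
    case 4
    have "(1 - z - \<gamma> / 2) - (a - \<gamma> / 2 * a\<^sup>2 - a * z)
        = (1 - a) * (1 - z - \<gamma>) + \<gamma> / 2 * (1 - a)\<^sup>2"
      by (simp add: field_simps power2_eq_square)
    moreover have "0 \<le> (1 - a) * (1 - z - \<gamma>) + \<gamma> / 2 * (1 - a)\<^sup>2"
      using 4 assms by simp
    ultimately show ?thesis using 4 by (simp add: loss_def)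
  qed
qed

text \<open>Equality in the Fenchel inequality is attained, so the loss is a pointwise maximum of
  affine functions of \<open>z\<close>.\<close>

lemma loss_eq_linear:
  assumes "0 \<le> \<gamma>"
  obtains a where "0 \<le> a" "a \<le> 1" "loss \<gamma> z = a - \<gamma> / 2 * a\<^sup>2 - a * z"
proof -
  consider "\<gamma> = 0" "z \<le> 1" | "z > 1" | "\<gamma> > 0" "z \<le> 1" "1 - \<gamma> \<le> z" | "\<gamma> > 0" "z \<le> 1" "z < 1 - \<gamma>"
    using assms by linarith
  then show ?thesis
  proof cases
    case 1
    then show ?thesis using that[of 1] by (simp add: loss_def)
  next
    case 2
    then show ?thesis using that[of 0] by (simp add: loss_def)
  next
    case 3
    \<comment> \<open>The stationary point in \<open>a\<close> of the concave right-hand side; the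
      case bounds on \<open>z\<close> place it in the unit interval.\<close>
    then show ?thesis using that[of "(1 - z) / \<gamma>"]
      by (simp add: loss_def field_simps power2_eq_square)
  next
    case 4
    then show ?thesis using that[of 1] by (simp add: loss_def)
  qed
qed

text \<open>The affine minorant that touches the loss at the intermediate point lies below it at
  both endpoints.\<close>

lemma convex_on_loss:
  assumes "0 \<le> \<gamma>"
  shows "convex_on UNIV (loss \<gamma>)"
proof (rule convex_onI)
  fix t z w :: real
  assume t: "0 < t" "t < 1"
  obtain a where a: "0 \<le> a" "a \<le> 1"
    "loss \<gamma> ((1 - t) *\<^sub>R z + t *\<^sub>R w)
      = a - \<gamma> / 2 * a\<^sup>2 - a * ((1 - t) *\<^sub>R z + t *\<^sub>R w)"
    using loss_eq_linear[OF assms] .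
  have "(1 - t) * (a - \<gamma> / 2 * a\<^sup>2 - a * z) + t * (a - \<gamma> / 2 * a\<^sup>2 - a * w)
      \<le> (1 - t) * loss \<gamma> z + t * loss \<gamma> w"
    using t loss_ge_linear[OF assms a(1,2)] by (intro add_mono mult_left_mono) auto
  moreover have "(1 - t) * (a - \<gamma> / 2 * a\<^sup>2 - a * z) + t * (a - \<gamma> / 2 * a\<^sup>2 - a * w)
      = a - \<gamma> / 2 * a\<^sup>2 - a * ((1 - t) *\<^sub>R z + t *\<^sub>R w)"
    by (simp add: field_simps)
  ultimately show "loss \<gamma> ((1 - t) *\<^sub>R z + t *\<^sub>R w) \<le> (1 - t) * loss \<gamma> z + t * loss \<gamma> w"
    using a(3) by simp
qed simp

section \<open>The two halves of the duality gap\<close>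

text \<open>The last term is the source of strong convexity; the losses contribute only plain
  convexity.\<close>

lemma norm_convex_combination_sq:
  fixes A B :: "'a::real_inner"
  shows "(norm ((1 - t) *\<^sub>R A + t *\<^sub>R B))\<^sup>2
    = (1 - t) * (norm A)\<^sup>2 + t * (norm B)\<^sup>2 - t * (1 - t) * (norm (A - B))\<^sup>2"
  unfolding power2_norm_eq_inner by (simp add: inner_simps inner_commute algebra_simps)

lemma primal_obj_strongly_convex:
  fixes x :: "nat \<Rightarrow> real^'d" and A B :: "real^'d^'d"
  assumes "0 \<le> \<gamma>" "0 \<le> t" "t \<le> 1"
  shows "primal_obj n x y \<gamma> lam ((1 - t) *\<^sub>R A + t *\<^sub>R B)
    \<le> (1 - t) * primal_obj n x y \<gamma> lam A + t * primal_obj n x y \<gamma> lam B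
      - lam / 2 * (t * (1 - t) * (norm (A - B))\<^sup>2)"
proof -
  have "(\<Sum>s\<in>triplets n y. loss \<gamma> (((1 - t) *\<^sub>R A + t *\<^sub>R B) \<bullet> H x s))
      \<le> (\<Sum>s\<in>triplets n y. (1 - t) * loss \<gamma> (A \<bullet> H x s) + t * loss \<gamma> (B \<bullet> H x s))"
    using convex_onD[OF convex_on_loss[OF assms(1)] assms(2,3)]
    by (intro sum_mono) (simp add: inner_add_left)
  also have "\<dots> = (1 - t) * (\<Sum>s\<in>triplets n y. loss \<gamma> (A \<bullet> H x s))
      + t * (\<Sum>s\<in>triplets n y. loss \<gamma> (B \<bullet> H x s))"
    by (simp only: sum.distrib sum_distrib_left)
  finally have loss_sum: "(\<Sum>s\<in>triplets n y. loss \<gamma> (((1 - t) *\<^sub>R A + t *\<^sub>R B) \<bullet> H x s)) \<le> \<dots>" .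
  have "S + lam / 2 * ((1 - t) * a + t * b - c)
      \<le> (1 - t) * (SA + lam / 2 * a) + t * (SB + lam / 2 * b) - lam / 2 * c"
    if "S \<le> (1 - t) * SA + t * SB" for S SA SB a b c
    using that by (simp add: field_simps)
  from this[OF loss_sum] show ?thesis
    unfolding primal_obj_def frob_inner_eq_inner frob_norm_eq_norm norm_convex_combination_sq .
qed

text \<open>Minimality is tested along the segment from \<open>M\<close> to \<open>A\<close>.
  Dividing by \<open>t\<close> and letting \<open>t\<close> tend to 0 removes the factor
  \<open>1 - t\<close> without differentiating the loss.\<close>

lemma primal_obj_quadratic_growth:
  fixes x :: "nat \<Rightarrow> real^'d" and A M :: "real^'d^'d"
  assumes "0 \<le> \<gamma>" "psd A" and argmin: "is_arg_min (primal_obj n x y \<gamma> lam) psd M"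
  shows "lam / 2 * (norm (M - A))\<^sup>2 \<le> primal_obj n x y \<gamma> lam A - primal_obj n x y \<gamma> lam M"
proof -
  let ?P = "primal_obj n x y \<gamma> lam"
  let ?c = "lam / 2 * (norm (M - A))\<^sup>2"
  have "psd M"
    using argmin by (simp add: is_arg_min_def)
  have bound: "(1 - t) * ?c \<le> ?P A - ?P M" if t: "0 < t" "t < 1" for t
  proof -
    have "psd ((1 - t) *\<^sub>R M + t *\<^sub>R A)"
      using \<open>psd A\<close> \<open>psd M\<close> t by (simp add: psd_add psd_scaleR)
    then have "?P M \<le> ?P ((1 - t) *\<^sub>R M + t *\<^sub>R A)"
      using argmin by (simp add: is_arg_min_linorder)
    also have "\<dots> \<le> (1 - t) * ?P M + t * ?P A - lam / 2 * (t * (1 - t) * (norm (M - A))\<^sup>2)"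
      using t by (intro primal_obj_strongly_convex assms(1)) auto
    finally have "t * ((1 - t) * ?c) \<le> t * (?P A - ?P M)"
      by (simp add: field_simps)
    then show ?thesis
      using t by simp
  qed
  have "((\<lambda>t. (1 - t) * ?c) \<longlongrightarrow> (1 - 0) * ?c) (at_right 0)"
    by (intro tendsto_intros)
  moreover have "eventually (\<lambda>t. (1 - t) * ?c \<le> ?P A - ?P M) (at_right 0)"
    using bound by (auto simp: eventually_at_right_field intro!: exI[of _ 1])
  ultimately have "(1 - 0) * ?c \<le> ?P A - ?P M"
    by (rule tendsto_upperbound) simp
  then show ?thesis
    by simp
qed

lemma primal_dual_gap_ge:
  fixes x :: "nat \<Rightarrow> real^'d" and \<Gamma> M :: "real^'d^'d"
  assumes "0 \<le> \<gamma>" "0 < lam" and \<alpha>: "\<forall>t\<in>triplets n y. 0 \<le> \<alpha> t \<and> \<alpha> t \<le> 1"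
    and "psd \<Gamma>" "psd M"
  shows "lam / 2 * (norm (M - M_dual n x y lam \<alpha> \<Gamma>))\<^sup>2
    \<le> primal_obj n x y \<gamma> lam M - dual_obj n x y \<gamma> lam \<alpha> \<Gamma>"
proof -
  let ?T = "triplets n y"
  define A where "A = M_dual n x y lam \<alpha> \<Gamma>"
  have "(\<Sum>t\<in>?T. \<alpha> t *\<^sub>R H x t) + \<Gamma> = lam *\<^sub>R A"
    using \<open>0 < lam\<close> by (simp add: A_def M_dual_def)
  then have "(\<Sum>t\<in>?T. \<alpha> t * (M \<bullet> H x t)) + M \<bullet> \<Gamma> = lam * (M \<bullet> A)"
    by (metis (no_types, lifting) inner_add_right inner_scaleR_right inner_sum_right sum.cong)
  \<comment> \<open>The terms linear in \<open>M\<close> supply the cross term that completes the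
    square of \<open>M - A\<close>, and leave \<open>M \<bullet> \<Gamma>\<close> over.\<close>
  then have inner_A: "(\<Sum>t\<in>?T. \<alpha> t * (M \<bullet> H x t)) = lam * (M \<bullet> A) - M \<bullet> \<Gamma>"
    by simp
  have "(\<Sum>t\<in>?T. \<alpha> t - \<gamma> / 2 * (\<alpha> t)\<^sup>2 - \<alpha> t * (M \<bullet> H x t)) \<le> (\<Sum>t\<in>?T. loss \<gamma> (M \<bullet> H x t))"
    using \<alpha> by (intro sum_mono loss_ge_linear[OF assms(1)]) auto
  then have "sum \<alpha> ?T - \<gamma> / 2 * (\<Sum>t\<in>?T. (\<alpha> t)\<^sup>2) - lam * (M \<bullet> A) + M \<bullet> \<Gamma>
      \<le> (\<Sum>t\<in>?T. loss \<gamma> (M \<bullet> H x t))"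
    unfolding sum_subtractf sum_distrib_left[symmetric] inner_A by simp
  moreover have "lam / 2 * (norm (M - A))\<^sup>2
      = lam / 2 * (norm M)\<^sup>2 - lam * (M \<bullet> A) + lam / 2 * (norm A)\<^sup>2"
    unfolding power2_norm_eq_inner by (simp add: inner_simps inner_commute algebra_simps)
  ultimately show ?thesis
    using psd_inner_nonneg[OF \<open>psd M\<close> \<open>psd \<Gamma>\<close>]
    unfolding primal_obj_def dual_obj_def frob_inner_eq_inner frob_norm_eq_norm A_def[symmetric]
    by simp
qed

theorem theorem3p6:
  fixes n :: nat
    and x :: "nat \<Rightarrow> real^'d"
    and y :: "nat \<Rightarrow> 'c"
    and \<gamma> lam :: real
    and \<alpha> :: "nat \<times> nat \<times> nat \<Rightarrow> real"
    and \<Gamma> Mstar :: "real^'d^'d"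
  assumes "\<gamma> \<ge> 0"
    and "lam > 0"
    and "\<forall>t\<in>triplets n y. 0 \<le> \<alpha> t \<and> \<alpha> t \<le> 1"
    and "psd \<Gamma>"
    and "psd (M_dual n x y lam \<alpha> \<Gamma>)"
    and "is_arg_min (primal_obj n x y \<gamma> lam) psd Mstar"
  shows "(frob_norm (Mstar - M_dual n x y lam \<alpha> \<Gamma>))\<^sup>2 \<le> duality_gap n x y \<gamma> lam \<alpha> \<Gamma> / lam"
proof -
  have "psd Mstar"
    using assms(6) by (simp add: is_arg_min_def)
  \<comment> \<open>Primal feasibility of the dual point allows it as the competitor in the growth
    bound; the two bounds with factor \<open>lam / 2\<close> add up.\<close>
  have "lam * (norm (Mstar - M_dual n x y lam \<alpha> \<Gamma>))\<^sup>2 \<le> duality_gap n x y \<gamma> lam \<alpha> \<Gamma>"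
    using primal_obj_quadratic_growth[OF assms(1,5,6)] primal_dual_gap_ge[OF assms(1-4) \<open>psd Mstar\<close>, of x]
    unfolding duality_gap_def by linarith
  then show ?thesis
    using assms(2) by (simp add: frob_norm_eq_norm field_simps)
qed

end
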